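(* (a) A function $f:\mathbb{R}\to\mathbb{R}$ is a measurable, not identically zero solution of the functional equation $$f(x+y)=f(x)f(y),\quad x,y\in\mathbb{R},$$ if and only if $(f(W_t),t\ge 0)$ is a strictly positive process such that $(\ln f(W_t),t\ge 0)\in\mathcal{M}$ and $\ln f(W_t)$ equals zero at time $t=0$. (b) A function $f:\mathbb{R}_+\to\mathbb{R}$ is a measurable solution of the functional equation $$f(x)+f(y)=f(xy),\quad x,y\in\mathbb{R}_+,$$ if and only if the process $(f(e^{W_t}),t\ge 0)$ belongs to $\mathcal{M}$ and equals zero at time $t=0$. (c) A function $f:\mathbb{R}_+\to\mathbb{R}$ is a measurable, not identically zero solution of the functional equation $$f(xy)=f(x)f(y),\quad x,y\in\mathbb{R}_+,$$ if and only if $(f(e^{W_t}),t\ge 0)$ is a strictly positive process such that $(\ln f(e^{W_t}),t\ge 0)\in\mathcal{M}$ and $\ln f(e^{W_t})$ equals zero at time $t=0$.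
   Context: $\mathbb{R}_+$ denotes the set of (strictly) positive real numbers. $W=(W_t,t\ge 0)$ is a standard Brownian motion (so $W_0=0$) on a complete probability space $(\Omega,\mathcal{F},P)$. $(\mathcal{F}_t)_{t\ge 0}$ is a filtration satisfying the usual conditions of right-continuity and completeness, containing the filtration generated by $W$, such that $W_t-W_s$ is independent of $\mathcal{F}_s$ whenever $0\le s\le t$ (so $W$ is a Brownian motion with respect to $(\mathcal{F}_t)$), and large enough to support an additional Brownian motion $B$ independent of $W$. $\mathcal{M}$ denotes the class of $(\mathcal{F}_t)$-martingales with $P$-almost surely right-continuous paths. "Measurable" means Lebesgue measurable; only Lebesgue measurable real functions are considered. *)

theory Defs
  imports "HOL-Probability.Probability"
begin

text \<open>
  Processes and filtrations indexed by \<open>[0, \<infinity>)\<close> are functions on \<^typ>\<open>real\<close> of which only the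
  values at \<open>t \<ge> 0\<close> matter.
\<close>

definition usual_filtration :: "'a measure \<Rightarrow> (real \<Rightarrow> 'a measure) \<Rightarrow> bool" where
  "usual_filtration M F \<longleftrightarrow>
     (\<forall>t\<ge>0. subalgebra M (F t)) \<and>
     (\<forall>s t. 0 \<le> s \<longrightarrow> s \<le> t \<longrightarrow> sets (F s) \<subseteq> sets (F t)) \<and>
     (\<forall>t\<ge>0. (\<Inter>s\<in>{t<..}. sets (F s)) = sets (F t)) \<and>
     null_sets M \<subseteq> sets (F 0)"

definition natural_filtration :: "'a measure \<Rightarrow> (real \<Rightarrow> 'a \<Rightarrow> real) \<Rightarrow> real \<Rightarrow> 'a measure" where
  "natural_filtration M X t =
     sigma (space M) {X s -` A \<inter> space M | s A. 0 \<le> s \<and> s \<le> t \<and> A \<in> sets borel}"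

definition standard_brownian_motion :: "'a measure \<Rightarrow> (real \<Rightarrow> 'a \<Rightarrow> real) \<Rightarrow> bool" where
  "standard_brownian_motion M W \<longleftrightarrow>
     (\<forall>t\<ge>0. W t \<in> borel_measurable M) \<and>
     (AE \<omega> in M. W 0 \<omega> = 0) \<and>
     (\<forall>(\<tau> :: nat \<Rightarrow> real) n. 0 \<le> \<tau> 0 \<longrightarrow> (\<forall>i<n. \<tau> i \<le> \<tau> (Suc i)) \<longrightarrow>
        prob_space.indep_vars M (\<lambda>_. borel) (\<lambda>i \<omega>. W (\<tau> (Suc i)) \<omega> - W (\<tau> i) \<omega>) {..<n}) \<and>
     (\<forall>s t. 0 \<le> s \<longrightarrow> s < t \<longrightarrow>
        distributed M lborel (\<lambda>\<omega>. W t \<omega> - W s \<omega>) (normal_density 0 (sqrt (t - s)))) \<and>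
     (AE \<omega> in M. continuous_on {0..} (\<lambda>t. W t \<omega>))"

text \<open>Independence of two processes means independence as random elements of the product space
  \<open>\<real>\<^bsup>[0, \<infinity>)\<^esup>\<close>.\<close>

definition indep_processes ::
  "'a measure \<Rightarrow> (real \<Rightarrow> 'a \<Rightarrow> real) \<Rightarrow> (real \<Rightarrow> 'a \<Rightarrow> real) \<Rightarrow> bool" where
  "indep_processes M X Y \<longleftrightarrow>
     prob_space.indep_var M
       (PiM {0..} (\<lambda>_. borel)) (\<lambda>\<omega>. \<lambda>t\<in>{0..}. X t \<omega>)
       (PiM {0..} (\<lambda>_. borel)) (\<lambda>\<omega>. \<lambda>t\<in>{0..}. Y t \<omega>)"

definition increments_indep_of ::
  "'a measure \<Rightarrow> (real \<Rightarrow> 'a measure) \<Rightarrow> (real \<Rightarrow> 'a \<Rightarrow> real) \<Rightarrow> bool" where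
  "increments_indep_of M F W \<longleftrightarrow>
     (\<forall>s t. 0 \<le> s \<longrightarrow> s \<le> t \<longrightarrow>
        prob_space.indep_set M (sets (F s))
          {(\<lambda>\<omega>. W t \<omega> - W s \<omega>) -` A \<inter> space M | A. A \<in> sets borel})"

definition rc_martingales ::
  "'a measure \<Rightarrow> (real \<Rightarrow> 'a measure) \<Rightarrow> (real \<Rightarrow> 'a \<Rightarrow> real) set" where
  "rc_martingales M F =
     {X. (\<forall>t\<ge>0. X t \<in> borel_measurable (F t)) \<and>
         (\<forall>t\<ge>0. integrable M (X t)) \<and>
         (\<forall>s t. 0 \<le> s \<longrightarrow> s \<le> t \<longrightarrow> (AE \<omega> in M. real_cond_exp M (F s) (X t) \<omega> = X s \<omega>)) \<and>
         (AE \<omega> in M. \<forall>t\<ge>0. continuous (at_right t) (\<lambda>u. X u \<omega>))}"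

end

theory Submission
  imports Defs "HOL-Real_Asymp.Real_Asymp"
begin

text \<open>
  Each of the three equations has an explicit family of measurable solutions, and each martingale
  condition turns out to describe the same family. After the substitution \<open>x = exp t\<close>, which
  preserves Lebesgue measurability in both directions, and after taking logarithms where the
  solution is positive, the measurable solutions are exactly the functions for which a transformed
  function \<open>g\<close> on the real line is linear. For additive functions this is Cauchy's theorem, proved
  through Steinhaus: a set of positive measure on which \<open>g\<close> is bounded has differences filling a
  neighbourhood of \<open>0\<close>, so \<open>g\<close> is bounded there (\<open>lebesgue_measurable_additive_linear\<close>).

  It remains to see that \<open>g(W)\<close> is a right-continuous martingale starting at \<open>0\<close> if and only if \<open>g\<close>
  is linear (\<open>martingale_iff_linear\<close>). Linear functions work because Brownian increments are
  centred, integrable and independent of the past. In the converse, \<open>g\<close> is an arbitrary function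
  whose measurability has itself to be derived, and the conclusion has to hold at every point. Three
  facts give it.

  \<^item> Regularity comes from the paths. At the last time before an upcrossing at which a continuous
    path is at level \<open>x\<close>, the path covers a right neighbourhood of \<open>x\<close> immediately afterwards.
    Right-continuity of \<open>g(W)\<close> at that time is therefore right-continuity of \<open>g\<close> at \<open>x\<close>;
    downcrossings give left-continuity. Every level is crossed in both directions with positive
    probability, so \<open>g\<close> is continuous (\<open>right_continuous_paths_imp_continuous\<close>). The
    positivity conditions pass from the process to the function by the same hitting of levels.

  \<^item> The martingale property between the times \<open>1\<close> and \<open>1 + u\<close>, the independence of the increment
    and Fubini say that \<open>g(x)\<close> equals the average of \<open>g\<close> under the normal law with mean \<open>x\<close> and
    variance \<open>u\<close>, for almost every \<open>x\<close>. Both sides are continuous in \<open>x\<close>, so this holds everywhere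
    (\<open>martingale_imp_gaussian_mean_AE\<close>, \<open>continuous_gaussian_mean\<close>).

  \<^item> A continuous function invariant under all these averages is affine
    (\<open>gaussian_invariant_imp_affine\<close>). Such functions obey a maximum principle: adding a small
    multiple of a convex quadratic makes the averages exceed the function by \<open>\<epsilon> * u\<close>, whereas
    near an interior maximum only the Gaussian tail can make a positive contribution, and the tail
    is \<open>o(u)\<close> as \<open>u\<close> tends to \<open>0\<close>. Applying this to the difference between \<open>g\<close> and a chord, with
    both signs, shows that \<open>g\<close> coincides with its chords.
\<close>

section \<open>Lebesgue measurable solutions of the Cauchy equations\<close>

text \<open>
  Subtracting the linear function that agrees with \<open>f\<close> at a point \<open>d\<close> leaves an additive function
  with period \<open>d\<close>. Boundedness near \<open>0\<close> then becomes boundedness everywhere, and an additive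
  function that is bounded everywhere vanishes because it is homogeneous over the naturals.
\<close>
lemma additive_bounded_near_zero_linear:
  fixes f :: "real \<Rightarrow> real"
  assumes add: "\<And>x y. f (x + y) = f x + f y"
    and "0 < \<delta>" and bound: "\<And>x. \<bar>x\<bar> < \<delta> \<Longrightarrow> \<bar>f x\<bar> \<le> B"
  shows "\<exists>c. \<forall>x. f x = c * x"
proof -
  define d where "d = \<delta> / 2"
  have d: "0 < d" "d < \<delta>" using \<open>0 < \<delta>\<close> by (auto simp: d_def)
  define c where "c = f d / d"
  have cd: "c * d = f d" using d by (simp add: c_def)
  define h where "h x = f x - c * x" for x
  have h_add: "h (x + y) = h x + h y" for x y
    by (simp add: h_def add ring_distribs)
  have h_0: "h 0 = 0" using h_add[of 0 0] by simp
  have h_mult: "h (of_nat n * x) = of_nat n * h x" for n x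
    by (induction n) (simp_all add: h_0 h_add ring_distribs)
  have h_minus: "h (- x) = - h x" for x
    using h_add[of x "- x"] h_0 by simp
  have h_d: "h (of_int k * d) = 0" for k
  proof -
    have "h d = 0" by (simp add: h_def cd)
    then have "h (of_nat n * d) = 0" for n by (simp add: h_mult)
    then show ?thesis
      by (cases k rule: int_cases2) (simp_all add: h_minus)
  qed
  have h_bound: "\<bar>h x\<bar> \<le> B + \<bar>f d\<bar>" for x
  proof -
    define k where "k = \<lfloor>x / d\<rfloor>"
    define r where "r = x - of_int k * d"
    have "of_int k \<le> x / d" "x / d < of_int k + 1" by (auto simp: k_def)
    then have r: "0 \<le> r" "r < d" using d by (auto simp: r_def field_simps)
    have "h x = h r" using h_add[of "of_int k * d" r] h_d by (simp add: r_def)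
    moreover have "\<bar>f r\<bar> \<le> B" using r d by (intro bound) auto
    moreover have "\<bar>c * r\<bar> \<le> \<bar>c * d\<bar>"
      using r by (simp add: abs_mult mult_left_mono)
    ultimately show ?thesis unfolding h_def cd by linarith
  qed
  have "h x = 0" for x
  proof (rule ccontr)
    assume "h x \<noteq> 0"
    then obtain n where "B + \<bar>f d\<bar> < of_nat n * \<bar>h x\<bar>"
      using reals_Archimedean3[of "\<bar>h x\<bar>"] by auto
    then show False using h_bound[of "of_nat n * x"] by (simp add: h_mult abs_mult)
  qed
  then have "f x = c * x" for x by (simp add: h_def)
  then show ?thesis by blast
qed

text \<open>
  Squeeze a compact set between \<open>S\<close> and an open set whose measure is less than twice as large.
  A small translate of the compact set stays within the open set, which has no room for two
  disjoint copies.
\<close>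
lemma steinhaus_difference_set:
  fixes S :: "real set"
  assumes S: "S \<in> lmeasurable" and bnd: "bounded S" and pos: "0 < measure lebesgue S"
  obtains \<delta> where "0 < \<delta>" "\<And>x. \<bar>x\<bar> < \<delta> \<Longrightarrow> \<exists>y\<in>S. x + y \<in> S"
proof -
  obtain T where T: "closed T" "T \<subseteq> S" "S - T \<in> lmeasurable"
      "emeasure lebesgue (S - T) < ennreal (measure lebesgue S)"
    using sets_lebesgue_inner_closed[of S "measure lebesgue S"] S pos by auto
  have T_meas: "T \<in> lmeasurable"
    using S T by (metis Diff_Diff_Int fmeasurable.Diff inf.absorb_iff2)
  have "measure lebesgue (S - T) < measure lebesgue S"
    using T pos by (simp add: emeasure_eq_measure2 ennreal_less_iff)
  then have posT: "0 < measure lebesgue T"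
    using measurable_measure_Diff[OF S fmeasurableD[OF T_meas] T(2)] by linarith
  have K: "compact T" "T \<subseteq> S" "0 < measure lebesgue T"
    using T posT bounded_subset[OF bnd T(2)] by (auto simp: compact_eq_bounded_closed)
  obtain U where U: "open U" "T \<subseteq> U" "U - T \<in> lmeasurable"
      "emeasure lebesgue (U - T) < ennreal (measure lebesgue T)"
    using sets_lebesgue_outer_open[OF fmeasurableD[OF T_meas] K(3)] .
  have U_meas: "U \<in> lmeasurable"
    using fmeasurable.Un[OF T_meas U(3)] U(2) by (simp add: Un_absorb1)
  have "measure lebesgue (U - T) < measure lebesgue T"
    using U T by (simp add: emeasure_eq_measure2 ennreal_less_iff)
  then have U_small: "measure lebesgue U < 2 * measure lebesgue T"
    using measurable_measure_Diff[OF U_meas fmeasurableD[OF T_meas] U(2)] by linarith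
  obtain \<delta> where \<delta>: "0 < \<delta>" "(\<Union>x\<in>T. ball x \<delta>) \<subseteq> U"
    by (rule compact_subset_open_imp_ball_epsilon_subset[OF K(1) U(1,2)])
  show thesis
  proof (rule that[OF \<delta>(1)])
    fix x :: real assume x: "\<bar>x\<bar> < \<delta>"
    let ?K' = "(+) x ` T"
    have sub: "?K' \<subseteq> U"
    proof
      fix z assume "z \<in> ?K'"
      then obtain y where "y \<in> T" "z \<in> ball y \<delta>" using x by (auto simp: dist_real_def)
      then show "z \<in> U" using \<delta>(2) by blast
    qed
    have K'_meas: "?K' \<in> lmeasurable"
      using K(1) by (intro lmeasurable_compact compact_translation)
    have "T \<inter> ?K' \<noteq> {}"
    proof
      assume "T \<inter> ?K' = {}"
      then have "measure lebesgue (T \<union> ?K') = 2 * measure lebesgue T"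
        using T_meas K'_meas by (simp add: measure_Un3 measure_translation)
      moreover have "measure lebesgue (T \<union> ?K') \<le> measure lebesgue U"
        using sub U U_meas T_meas K'_meas by (intro measure_mono_fmeasurable) (auto dest: fmeasurableD)
      ultimately show False using U_small by simp
    qed
    then show "\<exists>y\<in>S. x + y \<in> S" using K(2) by auto
  qed
qed

text \<open>
  The sets on which both the argument and \<open>f\<close> are bounded by \<open>n\<close> exhaust the line, so one of them has
  positive measure; by Steinhaus and additivity, \<open>f\<close> is bounded near \<open>0\<close>.
\<close>
lemma lebesgue_measurable_additive_linear:
  fixes f :: "real \<Rightarrow> real"
  assumes f[measurable]: "f \<in> borel_measurable lebesgue"
    and add: "\<And>x y. f (x + y) = f x + f y"
  shows "\<exists>c. \<forall>x. f x = c * x"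
proof -
  define A where "A n = {x \<in> cball 0 (real n). \<bar>f x\<bar> \<le> real n}" for n
  have A_sets: "A n \<in> sets lebesgue" for n
  proof -
    have "{x \<in> space lebesgue. \<bar>f x\<bar> \<le> real n} \<in> sets lebesgue" by measurable
    moreover have "A n = cball 0 (real n) \<inter> {x \<in> space lebesgue. \<bar>f x\<bar> \<le> real n}"
      by (auto simp: A_def)
    ultimately show ?thesis by auto
  qed
  have A_meas: "A n \<in> lmeasurable" for n
    by (intro bounded_set_imp_lmeasurable bounded_subset[OF bounded_cball[of 0 "real n"]] A_sets) (auto simp: A_def)
  have A_bounded: "bounded (A n)" for n
    by (rule bounded_subset[OF bounded_cball[of 0 "real n"]]) (auto simp: A_def)
  have "\<exists>n. 0 < measure lebesgue (A n)"
  proof (rule ccontr)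
    assume "\<nexists>n. 0 < measure lebesgue (A n)"
    then have "measure lebesgue (A n) = 0" for n
      by (metis less_eq_real_def measure_nonneg)
    then have "negligible (A n)" for n
      using A_meas by (simp add: negligible_iff_measure)
    then have "negligible (\<Union>n. A n)" by (intro negligible_Union_nat)
    moreover have "x \<in> (\<Union>n. A n)" for x
    proof -
      obtain n where "max \<bar>x\<bar> \<bar>f x\<bar> \<le> real n" using real_arch_simple by blast
      then show ?thesis by (auto simp: A_def intro!: exI[of _ n])
    qed
    then have "(\<Union>n. A n) = UNIV" by blast
    ultimately show False by (simp add: non_negligible_UNIV)
  qed
  then obtain n where "0 < measure lebesgue (A n)" ..
  then obtain \<delta> where \<delta>: "0 < \<delta>" "\<And>x. \<bar>x\<bar> < \<delta> \<Longrightarrow> \<exists>y\<in>A n. x + y \<in> A n"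
    using steinhaus_difference_set[OF A_meas A_bounded] by metis
  have bound: "\<bar>f x\<bar> \<le> 2 * real n" if x: "\<bar>x\<bar> < \<delta>" for x
  proof -
    obtain y where "y \<in> A n" "x + y \<in> A n" using \<delta>(2)[OF x] by blast
    then show ?thesis by (auto simp: A_def add)
  qed
  show ?thesis
    by (rule additive_bounded_near_zero_linear[where f = f and \<delta> = \<delta> and B = "2 * real n"])
      (use add \<delta>(1) bound in \<open>simp_all only:\<close>)
qed

text \<open>
  Composition with a Borel function does not preserve Lebesgue measurability in general. It does
  here because \<open>exp\<close> and \<open>ln\<close> are inverse to each other and differentiable maps send Lebesgue sets
  to Lebesgue sets.
\<close>
lemma exp_lebesgue_measurable:
  "exp \<in> measurable lebesgue (lebesgue_on {0 :: real <..})"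
proof (rule measurable_restrict_space2)
  show "exp \<in> measurable lebesgue (lebesgue :: real measure)"
  proof (rule measurableI)
    fix A :: "real set" assume A: "A \<in> sets lebesgue"
    have "exp -` A = ln ` (A \<inter> {0<..})"
    proof (intro equalityI subsetI)
      fix x assume "x \<in> exp -` A"
      then show "x \<in> ln ` (A \<inter> {0<..})"
        by (intro image_eqI[of _ _ "exp x"]) auto
    qed auto
    moreover have "ln ` (A \<inter> {0<..}) \<in> sets lebesgue"
    proof (rule differentiable_image_in_sets_lebesgue)
      show "A \<inter> {0<..} \<in> sets lebesgue" using A by auto
      show "ln differentiable_on A \<inter> {0<..}"
      proof (rule differentiable_at_imp_differentiable_on)
        fix x :: real assume "x \<in> A \<inter> {0<..}"
        then show "ln differentiable at x"
          using DERIV_ln[of x] by (auto simp: real_differentiable_def)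
      qed
    qed simp
    ultimately show "exp -` A \<inter> space lebesgue \<in> sets lebesgue" by simp
  qed simp
qed auto

lemma ln_lebesgue_measurable:
  "ln \<in> measurable (lebesgue_on {0 :: real <..}) lebesgue"
proof (rule measurableI)
  fix A :: "real set" assume A: "A \<in> sets lebesgue"
  have "ln -` A \<inter> {0<..} = exp ` A"
  proof (intro equalityI subsetI)
    fix y assume "y \<in> ln -` A \<inter> {0<..}"
    then show "y \<in> exp ` A" by (intro image_eqI[of _ _ "ln y"]) auto
  qed auto
  moreover have "exp ` A \<in> sets lebesgue"
  proof (rule differentiable_image_in_sets_lebesgue[OF A])
    show "exp differentiable_on A"
      by (rule differentiable_at_imp_differentiable_on) (auto intro!: exI DERIV_exp simp: real_differentiable_def)
  qed simp
  ultimately show "ln -` A \<inter> space (lebesgue_on {0<..}) \<in> sets (lebesgue_on {0 :: real<..})"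
    by (simp add: sets_restrict_space_iff image_subset_iff)
qed simp

lemma lebesgue_measurable_comp_exp_iff:
  fixes f :: "real \<Rightarrow> real"
  shows "(\<lambda>x. f (exp x)) \<in> borel_measurable lebesgue \<longleftrightarrow> f \<in> borel_measurable (lebesgue_on {0<..})"
proof
  assume "(\<lambda>x. f (exp x)) \<in> borel_measurable lebesgue"
  then have "(\<lambda>y. f (exp (ln y))) \<in> borel_measurable (lebesgue_on {0<..})"
    by (rule measurable_compose[OF ln_lebesgue_measurable])
  then show "f \<in> borel_measurable (lebesgue_on {0<..})"
    by (rule measurable_cong[THEN iffD1, rotated]) simp
qed (rule measurable_compose[OF exp_lebesgue_measurable])

lemma all_pos_iff_all_exp: "(\<forall>x>0. P x) \<longleftrightarrow> (\<forall>t :: real. P (exp t))"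
  by (metis exp_gt_zero exp_ln)

lemma ex_pos_iff_ex_exp: "(\<exists>x>0. P x) \<longleftrightarrow> (\<exists>t :: real. P (exp t))"
  by (metis exp_gt_zero exp_ln)

lemma additive_equation_iff:
  fixes f :: "real \<Rightarrow> real"
  shows "f \<in> borel_measurable lebesgue \<and> (\<forall>x y. f x + f y = f (x + y)) \<longleftrightarrow> (\<exists>c. \<forall>x. f x = c * x)"
proof
  assume "\<exists>c. \<forall>x. f x = c * x"
  then obtain c where f: "f = (\<lambda>x. c * x)" by auto
  have "(\<lambda>x. c * x) \<in> borel_measurable lebesgue" by (rule measurable_completion) simp
  then show "f \<in> borel_measurable lebesgue \<and> (\<forall>x y. f x + f y = f (x + y))"
    unfolding f by (simp add: distrib_left)
next
  assume f: "f \<in> borel_measurable lebesgue \<and> (\<forall>x y. f x + f y = f (x + y))"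
  show "\<exists>c. \<forall>x. f x = c * x"
    by (rule lebesgue_measurable_additive_linear) (use f in auto)
qed

text \<open>
  The value at \<open>x / 2\<close> is a factor of the nonzero value \<open>f a\<close>, and \<open>f x\<close> is the square of that factor.
\<close>
lemma exponential_equation_imp_positive:
  fixes f :: "real \<Rightarrow> real"
  assumes mult: "\<forall>x y. f (x + y) = f x * f y" and "f a \<noteq> 0"
  shows "0 < f x"
proof -
  have "f a = f (x / 2) * (f (x / 2) * f (a - x))"
    using mult[rule_format, of "x / 2" "a - x / 2"] mult[rule_format, of "x / 2" "a - x"]
    by (simp add: algebra_simps)
  then have "f (x / 2) \<noteq> 0" using \<open>f a \<noteq> 0\<close> by auto
  moreover have "f x = f (x / 2) * f (x / 2)" using mult[rule_format, of "x / 2" "x / 2"] by simp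
  ultimately show ?thesis by (auto simp: zero_less_mult_iff neq_iff)
qed

lemma exponential_equation_iff:
  fixes f :: "real \<Rightarrow> real"
  shows "f \<in> borel_measurable lebesgue \<and> (\<exists>x. f x \<noteq> 0) \<and> (\<forall>x y. f (x + y) = f x * f y)
    \<longleftrightarrow> (\<exists>c. \<forall>x. f x = exp (c * x))"
proof
  assume "\<exists>c. \<forall>x. f x = exp (c * x)"
  then obtain c where f: "f = (\<lambda>x. exp (c * x))" by auto
  have "(\<lambda>x. exp (c * x)) \<in> borel_measurable lebesgue" by (rule measurable_completion) simp
  then show "f \<in> borel_measurable lebesgue \<and> (\<exists>x. f x \<noteq> 0) \<and> (\<forall>x y. f (x + y) = f x * f y)"
    unfolding f by (simp add: distrib_left exp_add)
next
  assume f: "f \<in> borel_measurable lebesgue \<and> (\<exists>x. f x \<noteq> 0) \<and> (\<forall>x y. f (x + y) = f x * f y)"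
  then obtain a where "f a \<noteq> 0" by blast
  then have pos: "0 < f x" for x using f by (intro exponential_equation_imp_positive) auto
  have [measurable]: "f \<in> borel_measurable lebesgue" using f by simp
  have "(\<lambda>x. ln (f x)) \<in> borel_measurable lebesgue" by measurable
  moreover have "\<forall>x y. ln (f x) + ln (f y) = ln (f (x + y))" using f pos by (simp add: ln_mult_pos)
  ultimately obtain c where c: "\<And>x. ln (f x) = c * x"
    using additive_equation_iff[of "\<lambda>x. ln (f x)"] by blast
  have "f x = exp (c * x)" for x unfolding c[symmetric] using pos by simp
  then show "\<exists>c. \<forall>x. f x = exp (c * x)" by blast
qed

lemma logarithmic_equation_iff:
  fixes f :: "real \<Rightarrow> real"
  shows "f \<in> borel_measurable (lebesgue_on {0<..}) \<and> (\<forall>x>0. \<forall>y>0. f x + f y = f (x * y))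
    \<longleftrightarrow> (\<exists>c. \<forall>t. f (exp t) = c * t)"
  unfolding lebesgue_measurable_comp_exp_iff[symmetric] all_pos_iff_all_exp exp_add[symmetric]
  by (rule additive_equation_iff)

lemma power_equation_iff:
  fixes f :: "real \<Rightarrow> real"
  shows "f \<in> borel_measurable (lebesgue_on {0<..}) \<and> (\<exists>x>0. f x \<noteq> 0) \<and> (\<forall>x>0. \<forall>y>0. f (x * y) = f x * f y)
    \<longleftrightarrow> (\<exists>c. \<forall>t. f (exp t) = exp (c * t))"
  unfolding lebesgue_measurable_comp_exp_iff[symmetric] all_pos_iff_all_exp ex_pos_iff_ex_exp exp_add[symmetric]
  by (rule exponential_equation_iff)

section \<open>Continuous functions invariant under Gaussian averaging\<close>

text \<open>
  Doubling the variance absorbs a shift of the mean, because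
  \<open>y\<^sup>2 \<le> 2 * (y - c)\<^sup>2 + 2 * c\<^sup>2\<close>. The constant is bounded for bounded \<open>c\<close>, which makes this a
  dominating function when the mean varies.
\<close>
lemma normal_density_le_centred:
  assumes "0 < \<sigma>"
  shows "normal_density c \<sigma> y \<le> sqrt 2 * exp (c\<^sup>2 / (2 * \<sigma>\<^sup>2)) * normal_density 0 (sqrt 2 * \<sigma>) y"
proof -
  have "y\<^sup>2 \<le> 2 * (y - c)\<^sup>2 + 2 * c\<^sup>2"
    using zero_le_power2[of "y - 2 * c"] by (simp add: power2_eq_square algebra_simps)
  then have "- (y - c)\<^sup>2 / (2 * \<sigma>\<^sup>2) \<le> c\<^sup>2 / (2 * \<sigma>\<^sup>2) + - y\<^sup>2 / (4 * \<sigma>\<^sup>2)"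
    using assms by (simp add: divide_simps)
  then have le: "exp (- (y - c)\<^sup>2 / (2 * \<sigma>\<^sup>2)) \<le> exp (c\<^sup>2 / (2 * \<sigma>\<^sup>2)) * exp (- y\<^sup>2 / (4 * \<sigma>\<^sup>2))"
    by (simp flip: exp_add)
  have "1 / sqrt (2 * pi * \<sigma>\<^sup>2) = sqrt 2 / sqrt (2 * pi * (sqrt 2 * \<sigma>)\<^sup>2)"
    by (simp add: power_mult_distrib real_sqrt_mult real_div_sqrt divide_simps)
  then show ?thesis
    using mult_left_mono[OF le, of "1 / sqrt (2 * pi * \<sigma>\<^sup>2)"]
    by (simp add: normal_density_def power_mult_distrib mult_ac)
qed

text \<open>
  The heat semigroup at time \<open>u\<close>: the expectation of \<open>g\<close> under the normal law with mean \<open>x\<close> and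
  variance \<open>u\<close>.
\<close>
definition gaussian_mean :: "real \<Rightarrow> (real \<Rightarrow> real) \<Rightarrow> real \<Rightarrow> real" where
  "gaussian_mean u g x = (\<integral>y. normal_density x (sqrt u) y * g y \<partial>lborel)"

text \<open>
  Integrability of \<open>g(W\<^sub>u)\<close> at all positive times \<open>u\<close> has exactly this form. It extends to normal
  laws with other means by \<open>normal_density_le_centred\<close>.
\<close>
definition gaussian_integrable :: "(real \<Rightarrow> real) \<Rightarrow> bool" where
  "gaussian_integrable g \<longleftrightarrow> (\<forall>u>0. integrable lborel (\<lambda>y. normal_density 0 (sqrt u) y * g y))"

lemma gaussian_integrable_shifted:
  assumes g: "gaussian_integrable g" "g \<in> borel_measurable borel" and "0 < u"
  shows "integrable lborel (\<lambda>y. normal_density x (sqrt u) y * g y)"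
proof (rule Bochner_Integration.integrable_bound)
  let ?K = "sqrt 2 * exp (x\<^sup>2 / (2 * u))"
  show "integrable lborel (\<lambda>y. ?K * (normal_density 0 (sqrt (2 * u)) y * g y))"
    using g(1) \<open>0 < u\<close> by (auto simp: gaussian_integrable_def)
  have "normal_density x (sqrt u) y * \<bar>g y\<bar> \<le> ?K * normal_density 0 (sqrt (2 * u)) y * \<bar>g y\<bar>" for y
    using normal_density_le_centred[of "sqrt u" x y] \<open>0 < u\<close>
    by (intro mult_right_mono) (auto simp: real_sqrt_mult)
  then show "AE y in lborel. norm (normal_density x (sqrt u) y * g y)
      \<le> norm (?K * (normal_density 0 (sqrt (2 * u)) y * g y))"
    by (auto simp: abs_mult mult.assoc)
qed (use g(2) in measurable)

lemma continuous_gaussian_mean: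
  assumes g: "gaussian_integrable g" "g \<in> borel_measurable borel" and "0 < u"
  shows "continuous_on UNIV (gaussian_mean u g)"
proof (rule continuous_at_imp_continuous_on, rule ballI)
  fix x :: real
  have "(\<lambda>n. gaussian_mean u g (X n)) \<longlonglongrightarrow> gaussian_mean u g x" if X: "X \<longlonglongrightarrow> x" for X
  proof -
    obtain R where R: "\<And>n. \<bar>X n\<bar> \<le> R"
      using X convergent_imp_Bseq[of X] by (auto simp: convergent_def Bseq_def)
    let ?K = "sqrt 2 * exp (R\<^sup>2 / (2 * u))"
    show ?thesis unfolding gaussian_mean_def
    proof (rule integral_dominated_convergence)
      show "integrable lborel (\<lambda>y. ?K * \<bar>normal_density 0 (sqrt (2 * u)) y * g y\<bar>)"
        using g(1) \<open>0 < u\<close> by (auto simp: gaussian_integrable_def)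
      show "AE y in lborel. (\<lambda>n. normal_density (X n) (sqrt u) y * g y) \<longlonglongrightarrow> normal_density x (sqrt u) y * g y"
        using \<open>0 < u\<close> unfolding normal_density_def by (intro AE_I2 tendsto_intros X) auto
      fix n
      have "(X n)\<^sup>2 \<le> R\<^sup>2" using R[of n] by (rule power2_le_iff_abs_le[THEN iffD2, rotated]) (use R[of n] in linarith)
      then have "exp ((X n)\<^sup>2 / (2 * u)) \<le> exp (R\<^sup>2 / (2 * u))"
        using \<open>0 < u\<close> by (simp add: divide_right_mono)
      then have "sqrt 2 * exp ((X n)\<^sup>2 / (2 * u)) * normal_density 0 (sqrt (2 * u)) y
          \<le> ?K * normal_density 0 (sqrt (2 * u)) y" for y
        by (intro mult_right_mono mult_left_mono) auto
      then have "normal_density (X n) (sqrt u) y \<le> ?K * normal_density 0 (sqrt (2 * u)) y" for y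
        using normal_density_le_centred[of "sqrt u" "X n" y] \<open>0 < u\<close>
        by (intro order_trans[OF normal_density_le_centred]) (auto simp: real_sqrt_mult)
      then have "normal_density (X n) (sqrt u) y * \<bar>g y\<bar> \<le> ?K * normal_density 0 (sqrt (2 * u)) y * \<bar>g y\<bar>" for y
        by (intro mult_right_mono) auto
      then show "AE y in lborel. norm (normal_density (X n) (sqrt u) y * g y)
          \<le> ?K * \<bar>normal_density 0 (sqrt (2 * u)) y * g y\<bar>"
        by (auto simp: abs_mult mult.assoc)
    qed (use g(2) in measurable)
  qed
  then show "isCont (gaussian_mean u g) x"
    by (auto simp: continuous_at_sequentially o_def)
qed

lemma has_gaussian_mean_quadratic:
  assumes "0 < u"
  shows "has_bochner_integral lborel (\<lambda>y. normal_density x (sqrt u) y * (p + q * y + r * y\<^sup>2))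
    (p + q * x + r * (x\<^sup>2 + u))"
proof -
  have m: "has_bochner_integral lborel (normal_density x (sqrt u)) 1"
    "has_bochner_integral lborel (\<lambda>y. normal_density x (sqrt u) y * (y - x)) 0"
    "has_bochner_integral lborel (\<lambda>y. normal_density x (sqrt u) y * (y - x)\<^sup>2) u"
    using normal_moment_even[of "sqrt u" x 0] normal_moment_odd[of "sqrt u" x 0]
      normal_moment_even[of "sqrt u" x 1] assms by (auto simp: fact_numeral)
  have "has_bochner_integral lborel (\<lambda>y.
      (p + q * x + r * x\<^sup>2) * normal_density x (sqrt u) y
      + (q + 2 * r * x) * (normal_density x (sqrt u) y * (y - x))
      + r * (normal_density x (sqrt u) y * (y - x)\<^sup>2))
    ((p + q * x + r * x\<^sup>2) * 1 + (q + 2 * r * x) * 0 + r * u)"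
    by (intro has_bochner_integral_add has_bochner_integral_mult_right m)
  then show ?thesis
    by (rule has_bochner_integral_cong[THEN iffD1, rotated -1])
      (auto simp: power2_eq_square algebra_simps)
qed

lemma gaussian_integrable_quadratic: "gaussian_integrable (\<lambda>y. p + q * y + r * y\<^sup>2)"
  using has_gaussian_mean_quadratic[of _ 0 p q r]
  by (auto simp: gaussian_integrable_def has_bochner_integral_iff)

lemma gaussian_mean_quadratic:
  "0 < u \<Longrightarrow> gaussian_mean u (\<lambda>y. p + q * y + r * y\<^sup>2) x = p + q * x + r * (x\<^sup>2 + u)"
  using has_gaussian_mean_quadratic[of u x p q r]
  by (auto simp: gaussian_mean_def has_bochner_integral_iff)

lemma gaussian_integrable_add:
  "gaussian_integrable f \<Longrightarrow> gaussian_integrable g \<Longrightarrow> gaussian_integrable (\<lambda>x. f x + g x)"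
  by (auto simp: gaussian_integrable_def distrib_left)

lemma gaussian_mean_add:
  assumes "gaussian_integrable f" "f \<in> borel_measurable borel"
    and "gaussian_integrable g" "g \<in> borel_measurable borel" and "0 < u"
  shows "gaussian_mean u (\<lambda>x. f x + g x) x = gaussian_mean u f x + gaussian_mean u g x"
  using assms by (simp add: gaussian_mean_def distrib_left gaussian_integrable_shifted)

text \<open>
  Away from the mean, the density with small variance is exponentially small relative to the one
  with unit variance. The latter serves as a fixed integrable weight while \<open>u\<close> tends to \<open>0\<close>.
\<close>
lemma normal_density_tail_le:
  assumes "0 < u" "u \<le> 1" "0 < \<delta>" "\<delta> \<le> \<bar>y - m\<bar>"
  shows "normal_density m (sqrt u) y \<le> exp (- (\<delta>\<^sup>2 * (1 / u - 1)) / 2) / sqrt u * normal_density m 1 y"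
proof -
  have "\<delta>\<^sup>2 \<le> (y - m)\<^sup>2" using assms by (metis abs_le_square_iff abs_of_pos)
  then have "\<delta>\<^sup>2 * (1 / u - 1) \<le> (y - m)\<^sup>2 * (1 / u - 1)"
    using assms by (intro mult_right_mono) auto
  moreover have "- (y - m)\<^sup>2 / (2 * u) = - ((y - m)\<^sup>2 * (1 / u - 1)) / 2 + - (y - m)\<^sup>2 / 2"
    using assms by (simp add: field_simps)
  ultimately have "- (y - m)\<^sup>2 / (2 * u) \<le> - (\<delta>\<^sup>2 * (1 / u - 1)) / 2 + - (y - m)\<^sup>2 / 2"
    by simp
  then have "exp (- (y - m)\<^sup>2 / (2 * u)) \<le> exp (- (\<delta>\<^sup>2 * (1 / u - 1)) / 2) * exp (- (y - m)\<^sup>2 / 2)"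
    by (simp flip: exp_add)
  then show ?thesis using assms
    by (simp add: normal_density_def real_sqrt_mult divide_simps)
qed

text \<open>
  If \<open>h c\<close> were positive, then \<open>k x = h x + \<epsilon> * ((x - a) * (x - b))\<close> would still have a positive
  maximum at an interior point \<open>m\<close>. Its Gaussian mean at \<open>m\<close> exceeds \<open>k m\<close> by exactly \<open>\<epsilon> * u\<close>, the
  variance times the leading coefficient. Since \<open>k y \<le> k m\<close> near \<open>m\<close>, this excess can only come
  from the tail, and so it is \<open>o(u)\<close>: a contradiction.
\<close>
lemma gaussian_invariant_maximum_principle:
  fixes h :: "real \<Rightarrow> real"
  assumes cont: "continuous_on UNIV h" and int: "gaussian_integrable h"
    and inv: "\<And>u x. 0 < u \<Longrightarrow> gaussian_mean u h x = h x"
    and ab: "h a \<le> 0" "h b \<le> 0" and c: "a < c" "c < b"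
  shows "h c \<le> 0"
proof (rule ccontr)
  assume "\<not> h c \<le> 0"
  then have hc: "0 < h c" by simp
  have h_borel: "h \<in> borel_measurable borel" using cont by (rule borel_measurable_continuous_onI)
  \<comment> \<open>chosen so that the perturbation takes away half of \<open>h c\<close> at the point \<open>c\<close>\<close>
  define \<epsilon> where "\<epsilon> = h c / (2 * ((c - a) * (b - c)))"
  have \<epsilon>: "0 < \<epsilon>" using hc c by (simp add: \<epsilon>_def)
  let ?q = "\<lambda>x. \<epsilon> * (a * b) + (- \<epsilon> * (a + b)) * x + \<epsilon> * x\<^sup>2"
  define k where "k x = h x + ?q x" for x
  have q: "?q x = \<epsilon> * ((x - a) * (x - b))" for x
    by (simp add: power2_eq_square algebra_simps)
  have k_cont: "continuous_on S k" for S unfolding k_def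
    by (intro continuous_intros continuous_on_subset[OF cont]) auto
  have k_borel: "k \<in> borel_measurable borel" using k_cont by (rule borel_measurable_continuous_onI)
  have k_int: "gaussian_integrable k" unfolding k_def
    by (intro gaussian_integrable_add int gaussian_integrable_quadratic)
  have k_mean: "gaussian_mean u k x = k x + \<epsilon> * u" if "0 < u" for u x
  proof -
    have "gaussian_mean u k x = gaussian_mean u h x + gaussian_mean u ?q x"
      unfolding k_def
      by (rule gaussian_mean_add[OF int h_borel gaussian_integrable_quadratic _ that]) measurable
    also have "\<dots> = k x + \<epsilon> * u"
      using that by (simp only: inv gaussian_mean_quadratic k_def) (simp add: algebra_simps)
    finally show ?thesis .
  qed
  have "k c = h c - \<epsilon> * ((c - a) * (b - c))"
    unfolding k_def q by (simp add: algebra_simps)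
  also have "\<dots> = h c / 2" using c by (simp add: \<epsilon>_def)
  finally have kc: "0 < k c" using hc by simp
  obtain m where m: "m \<in> {a..b}" "\<And>y. y \<in> {a..b} \<Longrightarrow> k y \<le> k m"
    using continuous_attains_sup[of "{a..b}" k] k_cont c by auto
  have "0 < k m" using m(2)[of c] c kc by auto
  then have "m \<noteq> a" "m \<noteq> b" using ab unfolding k_def q by auto
  then have m': "a < m" "m < b" using m(1) by auto
  define \<delta> where "\<delta> = min (m - a) (b - m)"
  have \<delta>: "0 < \<delta>" using m' by (simp add: \<delta>_def)
  let ?r = "\<lambda>u. exp (- (\<delta>\<^sup>2 * (1 / u - 1)) / 2) / sqrt u"
  define C where "C = (\<integral>y. normal_density m (sqrt 1) y * \<bar>k y - k m\<bar> \<partial>lborel)"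
  have km_int: "gaussian_integrable (\<lambda>y. k y - k m)"
    using k_int gaussian_integrable_quadratic[of "- k m" 0 0] gaussian_integrable_add[of k "\<lambda>_. - k m"] by auto
  have shifted: "integrable lborel (\<lambda>y. normal_density m (sqrt u) y * (k y - k m))" if "0 < u" for u
    using that km_int k_borel by (intro gaussian_integrable_shifted) auto
  have shifted_abs: "integrable lborel (\<lambda>y. normal_density m (sqrt 1) y * \<bar>k y - k m\<bar>)"
    using integrable_abs[OF shifted[of 1]] by (simp add: abs_mult)
  have bound: "\<epsilon> * u \<le> ?r u * C" if u: "0 < u" "u \<le> 1" for u
  proof -
    have "\<epsilon> * u = (\<integral>y. normal_density m (sqrt u) y * (k y - k m) \<partial>lborel)"
      using u k_int k_borel k_mean[of u m] gaussian_integrable_shifted[of k u m]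
      by (simp add: gaussian_mean_def right_diff_distrib)
    also have "\<dots> \<le> (\<integral>y. ?r u * (normal_density m (sqrt 1) y * \<bar>k y - k m\<bar>) \<partial>lborel)"
    proof (rule integral_mono)
      fix y
      show "normal_density m (sqrt u) y * (k y - k m)
          \<le> ?r u * (normal_density m (sqrt 1) y * \<bar>k y - k m\<bar>)"
      proof (cases "\<bar>y - m\<bar> < \<delta>")
        case True
        then have "k y \<le> k m" by (intro m(2)) (auto simp: \<delta>_def)
        then have "normal_density m (sqrt u) y * (k y - k m) \<le> 0"
          by (simp add: mult_nonneg_nonpos)
        also have "0 \<le> ?r u * (normal_density m (sqrt 1) y * \<bar>k y - k m\<bar>)"
          using u by simp
        finally show ?thesis .
      next
        case False
        then have "normal_density m (sqrt u) y \<le> ?r u * normal_density m 1 y"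
          using u \<delta> by (intro normal_density_tail_le) auto
        then have "normal_density m (sqrt u) y * \<bar>k y - k m\<bar> \<le> ?r u * normal_density m 1 y * \<bar>k y - k m\<bar>"
          by (rule mult_right_mono) simp
        moreover have "normal_density m (sqrt u) y * (k y - k m) \<le> normal_density m (sqrt u) y * \<bar>k y - k m\<bar>"
          by (rule mult_left_mono) auto
        ultimately show ?thesis by (simp add: mult.assoc)
      qed
    qed (use u shifted shifted_abs in auto)
    also have "\<dots> = ?r u * C" by (simp add: C_def)
    finally show ?thesis .
  qed
  have "((\<lambda>u. ?r u * C / u) \<longlongrightarrow> 0) (at_right 0)"
    using \<delta> by real_asymp
  moreover have "\<forall>\<^sub>F u in at_right 0. \<epsilon> \<le> ?r u * C / u"
    using eventually_at_right_real[OF zero_less_one] by eventually_elim (use bound in \<open>subst pos_le_divide_eq, auto\<close>)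
  ultimately have "\<epsilon> \<le> 0"
    by (intro tendsto_lowerbound) (auto simp: trivial_limit_at_right_real)
  then show False using \<epsilon> by simp
qed

text \<open>
  Affine functions are invariant as well, so the maximum principle applies to the difference of \<open>g\<close>
  and its chord over \<open>[a, b]\<close>, and to the negative of this difference.
\<close>
lemma gaussian_invariant_imp_affine:
  fixes g :: "real \<Rightarrow> real"
  assumes cont: "continuous_on UNIV g" and int: "gaussian_integrable g"
    and inv: "\<And>u x. 0 < u \<Longrightarrow> gaussian_mean u g x = g x"
  shows "g x = g 0 + (g 1 - g 0) * x"
proof -
  have chord: "(b - a) * g c = (b - c) * g a + (c - a) * g b" if abc: "a < c" "c < b" for a b c
  proof -
    have g_borel: "g \<in> borel_measurable borel" using cont by (rule borel_measurable_continuous_onI)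
    define l1 where "l1 = (g b - g a) / (b - a)"
    define l0 where "l0 = g a - l1 * a"
    have nz: "b - a \<noteq> 0" using abc by simp
    have l: "l0 + l1 * a = g a" "l0 + l1 * b = g b"
    proof -
      have "l1 * (b - a) = g b - g a" using nz by (simp add: l1_def)
      then show "l0 + l1 * a = g a" "l0 + l1 * b = g b" by (auto simp: l0_def algebra_simps)
    qed
    \<comment> \<open>the sign \<open>s\<close> treats the upper and the lower bound together\<close>
    have le: "s * (g c - (l0 + l1 * c)) \<le> 0" if "s = 1 \<or> s = -1" for s
    proof -
      let ?h = "\<lambda>x. s * g x + ((- s * l0) + (- s * l1) * x + 0 * x\<^sup>2)"
      have sg: "gaussian_integrable (\<lambda>x. s * g x)"
        using int by (auto simp: gaussian_integrable_def mult.left_commute)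
      have "?h c \<le> 0"
      proof (rule gaussian_invariant_maximum_principle[of ?h a b c])
        show "continuous_on UNIV ?h" using cont by (intro continuous_intros)
        show "gaussian_integrable ?h"
          by (intro gaussian_integrable_add sg gaussian_integrable_quadratic)
        show "gaussian_mean u ?h x = ?h x" if "0 < u" for u x
        proof -
          have "gaussian_mean u (\<lambda>x. s * g x) x = s * g x"
            using inv[OF that, of x] by (simp add: gaussian_mean_def mult.left_commute)
          moreover have "gaussian_mean u ?h x = gaussian_mean u (\<lambda>x. s * g x) x
              + gaussian_mean u (\<lambda>x. (- s * l0) + (- s * l1) * x + 0 * x\<^sup>2) x"
            using g_borel
            by (intro gaussian_mean_add[OF sg _ gaussian_integrable_quadratic _ that]
                borel_measurable_continuous_onI[of "\<lambda>x. _ + _ * x + _ * x\<^sup>2"] continuous_intros) measurable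
          ultimately show ?thesis
            using gaussian_mean_quadratic[OF that, of "- s * l0" "- s * l1" 0 x] by simp
        qed
        show "?h a \<le> 0" "?h b \<le> 0" unfolding l[symmetric] by (auto simp: algebra_simps)
      qed (use abc in auto)
      then show ?thesis by (simp add: algebra_simps)
    qed
    have "g c = l0 + l1 * c" using le[of 1] le[of "-1"] by auto
    then have "(b - a) * g c = (b - c) * (l0 + l1 * a) + (c - a) * (l0 + l1 * b)"
      by (simp add: algebra_simps)
    then show ?thesis by (simp add: l)
  qed
  consider "x < 0" | "x = 0" | "0 < x \<and> x < 1" | "x = 1" | "1 < x" by linarith
  then show ?thesis
  proof cases
    case 1
    then show ?thesis using chord[of x 0 1] by (simp add: algebra_simps)
  next
    case 3
    then show ?thesis using chord[of 0 x 1] by (simp add: algebra_simps)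
  next
    case 5
    then show ?thesis using chord[of 0 1 x] by (simp add: algebra_simps)
  qed auto
qed

section \<open>Right-continuity along a path that crosses a level\<close>

text \<open>
  Let \<open>r\<close> be the last time in \<open>[a, b]\<close> at which the path is not above \<open>x\<close>. Then the path is at \<open>x\<close> at
  time \<open>r\<close> and above \<open>x\<close> afterwards, and by the intermediate value theorem every level slightly
  above \<open>x\<close> is attained immediately after \<open>r\<close>.
\<close>
lemma path_crossing_right_continuous:
  fixes w :: "real \<Rightarrow> real" and g :: "real \<Rightarrow> 'b :: metric_space"
  assumes w: "continuous_on {a..b} w"
    and rc: "\<And>t. a \<le> t \<Longrightarrow> t < b \<Longrightarrow> continuous (at_right t) (\<lambda>u. g (w u))"
    and "a \<le> b" "w a \<le> x" "x < w b"
  shows "continuous (at_right x) g"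
proof -
  let ?S = "{r \<in> {a..b}. w r \<le> x}"
  have "closed ?S"
    by (rule continuous_on_closed_Collect_le[OF w]) auto
  then have "compact ?S"
    by (auto simp: compact_eq_bounded_closed intro: bounded_subset[OF bounded_closed_interval[of a b]])
  moreover have "?S \<noteq> {}" using assms by auto
  ultimately obtain r where r: "r \<in> ?S" "\<And>r'. r' \<in> ?S \<Longrightarrow> r' \<le> r"
    using compact_attains_sup[of ?S] by blast
  have "r \<noteq> b" using r(1) \<open>x < w b\<close> by auto
  then have rb: "a \<le> r" "r < b" using r(1) by auto
  have wS: "continuous_on {r..b'} w" if "b' \<le> b" for b'
    using that rb by (intro continuous_on_subset[OF w]) auto
  obtain r' where "r \<le> r'" "r' \<le> b" "w r' = x"
    using IVT'[of w r x b] wS[of b] r(1) rb \<open>x < w b\<close> by auto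
  then have wr: "w r = x" using r(2)[of r'] rb by auto
  show ?thesis unfolding continuous_within
  proof (rule tendstoI)
    fix e :: real assume "0 < e"
    have "((\<lambda>u. g (w u)) \<longlongrightarrow> g x) (at_right r)"
      using rc[OF rb] by (simp add: continuous_within wr)
    then have "\<forall>\<^sub>F u in at_right r. dist (g (w u)) (g x) < e"
      using \<open>0 < e\<close> by (rule tendstoD)
    then obtain d where d: "r < d" "\<And>u. r < u \<Longrightarrow> u < d \<Longrightarrow> dist (g (w u)) (g x) < e"
      by (auto simp: eventually_at_right_field)
    define b' where "b' = min b ((r + d) / 2)"
    have b': "r < b'" "b' \<le> b" "b' < d" using rb d(1) by (simp_all add: b'_def min_less_iff_disj)
    have "x < w b'" using r(2)[of b'] b' rb by force
    moreover have "dist (g y) (g x) < e" if y: "x < y" "y < w b'" for y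
    proof -
      obtain u where u: "r \<le> u" "u \<le> b'" "w u = y"
        using IVT'[of w r y b'] wS[of b'] wr y b' by auto
      moreover have "u \<noteq> r" using u wr y by auto
      ultimately show ?thesis using d(2)[of u] b' by auto
    qed
    ultimately show "\<forall>\<^sub>F y in at_right x. dist (g y) (g x) < e"
      unfolding eventually_at_right_field by blast
  qed
qed

text \<open>
  The mirror image of the preceding lemma: reflect both the path and the argument of \<open>g\<close>.
\<close>
lemma path_crossing_left_continuous:
  fixes w :: "real \<Rightarrow> real" and g :: "real \<Rightarrow> 'b :: metric_space"
  assumes w: "continuous_on {a..b} w"
    and rc: "\<And>t. a \<le> t \<Longrightarrow> t < b \<Longrightarrow> continuous (at_right t) (\<lambda>u. g (w u))"
    and "a \<le> b" "x \<le> w a" "w b < x"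
  shows "continuous (at_left x) g"
proof -
  have "continuous (at_right (- x)) (\<lambda>y. g (- y))"
    by (rule path_crossing_right_continuous[of a b "\<lambda>t. - w t"])
      (use assms in \<open>auto intro: continuous_on_minus\<close>)
  then show ?thesis
    by (simp add: continuous_within filterlim_at_left_to_right)
qed

section \<open>Brownian motion in a filtration\<close>

text \<open>
  The normal density is positive everywhere, and a nonempty open set is not Lebesgue null.
\<close>
lemma (in prob_space) prob_normal_open_pos:
  assumes X: "distributed M lborel X (normal_density \<mu> \<sigma>)" and "0 < \<sigma>"
    and A: "open A" "A \<noteq> {}"
  shows "0 < prob (X -` A \<inter> space M)"
proof (rule ccontr)
  assume "\<not> ?thesis"
  then have "prob (X -` A \<inter> space M) = 0" by (simp add: not_less measure_le_0_iff)
  then have "emeasure M (X -` A \<inter> space M) = 0" by (simp add: emeasure_eq_measure)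
  moreover have "emeasure (distr M lborel X) A = emeasure M (X -` A \<inter> space M)"
    using X A by (intro emeasure_distr) (auto simp: distributed_def)
  ultimately have "emeasure (density lborel (normal_density \<mu> \<sigma>)) A = 0"
    using X by (simp add: distributed_def)
  then have "AE x in density lborel (normal_density \<mu> \<sigma>). x \<in> - A"
    using A by (intro AE_I[of _ _ A]) auto
  then have "AE x in lborel. x \<in> - A"
    using \<open>0 < \<sigma>\<close> by (simp add: AE_density normal_density_pos)
  then have "AE x in lebesgue. x \<in> - A" by (rule AE_completion)
  then have "x \<in> - A" for x using A(1) by (intro mem_closed_if_AE_lebesgue) auto
  then show False using A(2) by blast
qed

locale brownian_filtration = prob_space M for M :: "'a measure" +
  fixes F :: "real \<Rightarrow> 'a measure" and W :: "real \<Rightarrow> 'a \<Rightarrow> real"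
  assumes filtration: "usual_filtration M F"
    and brownian: "standard_brownian_motion M W"
    and natural_le: "\<forall>t\<ge>0. sets (natural_filtration M W t) \<subseteq> sets (F t)"
    and increments_indep: "increments_indep_of M F W"
begin

lemma subalgebra_F: "0 \<le> t \<Longrightarrow> subalgebra M (F t)"
  using filtration by (simp add: usual_filtration_def)

lemma measurable_F_imp_measurable:
  "0 \<le> t \<Longrightarrow> X \<in> measurable (F t) N \<Longrightarrow> X \<in> measurable M N"
  using measurable_from_subalg[OF subalgebra_F] .

lemma sigma_finite_subalgebra_F: "0 \<le> t \<Longrightarrow> sigma_finite_subalgebra M (F t)"
proof -
  assume "0 \<le> t"
  then interpret finite_measure_subalgebra M "F t"
    by unfold_locales (rule subalgebra_F)
  show ?thesis by unfold_locales
qed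

lemma W_adapted:
  assumes "0 \<le> t"
  shows "W t \<in> borel_measurable (F t)"
proof (rule measurableI)
  fix A :: "real set" assume "A \<in> sets borel"
  then have "W t -` A \<inter> space M \<in> sets (natural_filtration M W t)"
    unfolding natural_filtration_def using assms by (subst sets_measure_of) auto
  then show "W t -` A \<inter> space (F t) \<in> sets (F t)"
    using natural_le assms subalgebra_F[OF assms] by (auto simp: subalgebra_def)
qed simp

lemma W_measurable: "0 \<le> t \<Longrightarrow> W t \<in> borel_measurable M"
  using W_adapted measurable_F_imp_measurable by blast

lemma W_0: "AE \<omega> in M. W 0 \<omega> = 0"
  using brownian by (simp add: standard_brownian_motion_def)

lemma W_continuous: "AE \<omega> in M. continuous_on {0..} (\<lambda>t. W t \<omega>)"
  using brownian by (simp add: standard_brownian_motion_def)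

lemma distributed_increment:
  "0 \<le> s \<Longrightarrow> s < t \<Longrightarrow> distributed M lborel (\<lambda>\<omega>. W t \<omega> - W s \<omega>) (normal_density 0 (sqrt (t - s)))"
  using brownian by (simp add: standard_brownian_motion_def)

lemma distributed_W:
  assumes "0 < t"
  shows "distributed M lborel (W t) (normal_density 0 (sqrt t))"
proof -
  note D = distributed_increment[of 0 t]
  have "distr M lborel (W t) = distr M lborel (\<lambda>\<omega>. W t \<omega> - W 0 \<omega>)"
    using W_measurable[of t] W_measurable[of 0] W_0 assms by (intro distr_cong_AE) auto
  then show ?thesis using D assms W_measurable[of t]
    by (auto simp: distributed_def)
qed

text \<open>
  Independence from the sigma algebra \<open>F s\<close>, recast as independence of two random variables, so that
  joint laws are product measures and expectations of products factor.
\<close>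
lemma indep_past_increment:
  assumes st: "0 \<le> s" "s \<le> t" and X: "X \<in> borel_measurable (F s)"
  shows "indep_var borel X borel (\<lambda>\<omega>. W t \<omega> - W s \<omega>)"
proof -
  have ind: "indep_set (sets (F s)) {(\<lambda>\<omega>. W t \<omega> - W s \<omega>) -` A \<inter> space M | A. A \<in> sets borel}"
    using increments_indep st by (simp add: increments_indep_of_def)
  have sp: "space (F s) = space M" using subalgebra_F[OF st(1)] by (simp add: subalgebra_def)
  have stable: "Int_stable {(\<lambda>\<omega>. W t \<omega> - W s \<omega>) -` A \<inter> space M | A. A \<in> sets borel}"
  proof (rule Int_stableI, clarify)
    fix A B :: "real set" assume "A \<in> sets borel" "B \<in> sets borel"
    then show "\<exists>C. (\<lambda>\<omega>. W t \<omega> - W s \<omega>) -` A \<inter> space M \<inter> ((\<lambda>\<omega>. W t \<omega> - W s \<omega>) -` B \<inter> space M)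
        = (\<lambda>\<omega>. W t \<omega> - W s \<omega>) -` C \<inter> space M \<and> C \<in> sets borel"
      by (intro exI[of _ "A \<inter> B"]) auto
  qed
  have *: "sigma_sets (space M) (sets (F s)) = sets (F s)"
    using sp sets.sigma_sets_eq[of "F s"] by simp
  have sub: "sigma_sets (space M) {X -` A \<inter> space M | A. A \<in> sets borel} \<subseteq> sets (F s)"
    unfolding sp[symmetric] using measurable_sets[OF X]
    by (intro sets.sigma_sets_subset) auto
  have "indep_set (sigma_sets (space M) (sets (F s)))
      (sigma_sets (space M) {(\<lambda>\<omega>. W t \<omega> - W s \<omega>) -` A \<inter> space M | A. A \<in> sets borel})"
    by (rule indep_set_sigma_sets[OF ind sets.Int_stable stable])
  then have "indep_set (sigma_sets (space M) {X -` A \<inter> space M | A. A \<in> sets borel})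
      (sigma_sets (space M) {(\<lambda>\<omega>. W t \<omega> - W s \<omega>) -` A \<inter> space M | A. A \<in> sets borel})"
    using sub unfolding * indep_sets2_eq by blast
  then show ?thesis
    using measurable_F_imp_measurable[OF st(1) X] W_measurable[of s] W_measurable[of t] st
    unfolding indep_var_eq by auto
qed

section \<open>Regularity of a function inherited from Brownian paths\<close>

text \<open>
  The position at time \<open>1\<close> and the subsequent increment are independent, and each of them enters a
  nonempty open set with positive probability. The event that both happen therefore meets every
  event of probability one, which turns almost sure statements about paths into deterministic
  statements about levels.
\<close>
lemma ex_path_through:
  assumes P: "AE \<omega> in M. P \<omega>" and A: "open A" "A \<noteq> {}" and B: "open B" "B \<noteq> {}"
  obtains \<omega> where "P \<omega>" "continuous_on {0..} (\<lambda>t. W t \<omega>)" "W 1 \<omega> \<in> A" "W 2 \<omega> - W 1 \<omega> \<in> B"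
proof -
  let ?A = "W 1 -` A \<inter> space M" and ?B = "(\<lambda>\<omega>. W 2 \<omega> - W 1 \<omega>) -` B \<inter> space M"
  have "prob (?A \<inter> ?B) = prob ?A * prob ?B"
  proof -
    have "indep_set (sets (F 1)) {(\<lambda>\<omega>. W 2 \<omega> - W 1 \<omega>) -` A \<inter> space M | A. A \<in> sets borel}"
      using increments_indep by (auto simp: increments_indep_of_def)
    moreover have "?A \<in> sets (F 1)"
      using measurable_sets[OF W_adapted[of 1], of A] A subalgebra_F[of 1] by (simp add: subalgebra_def)
    ultimately show ?thesis using B by (intro indep_setD) auto
  qed
  moreover have "0 < prob ?A"
    using distributed_W[of 1] A by (intro prob_normal_open_pos[of _ 0 1]) auto
  moreover have "0 < prob ?B"
    using distributed_increment[of 1 2] B by (intro prob_normal_open_pos[of _ 0 1]) auto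
  ultimately have pos: "0 < prob (?A \<inter> ?B)" by simp
  have "\<exists>\<omega>. P \<omega> \<and> continuous_on {0..} (\<lambda>t. W t \<omega>) \<and> W 1 \<omega> \<in> A \<and> W 2 \<omega> - W 1 \<omega> \<in> B"
  proof (rule ccontr)
    assume none: "\<not> ?thesis"
    have "AE \<omega> in M. \<omega> \<notin> ?A \<inter> ?B"
      using P W_continuous by eventually_elim (use none in blast)
    then have "prob (?A \<inter> ?B) = 0"
      using AE_iff_null_sets[of "?A \<inter> ?B" M] measure_notin_sets[of "?A \<inter> ?B" M]
      by (cases "?A \<inter> ?B \<in> events") (auto simp: measure_eq_0_null_sets)
    then show False using pos by simp
  qed
  then show thesis using that by blast
qed

lemma ex_upcrossing_path:
  assumes "AE \<omega> in M. P \<omega>"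
  obtains \<omega> where "P \<omega>" "continuous_on {0..} (\<lambda>t. W t \<omega>)" "W 1 \<omega> < x" "x < W 2 \<omega>"
  by (rule ex_path_through[OF assms, of "{x - 1<..<x}" "{1<..}"]) (use gt_ex in auto)

lemma ex_downcrossing_path:
  assumes "AE \<omega> in M. P \<omega>"
  obtains \<omega> where "P \<omega>" "continuous_on {0..} (\<lambda>t. W t \<omega>)" "x < W 1 \<omega>" "W 2 \<omega> < x"
  by (rule ex_path_through[OF assms, of "{x<..<x + 1}" "{..<-1}"]) (use lt_ex in auto)

text \<open>
  Some path with the property crosses the level \<open>x\<close>, and hence is equal to \<open>x\<close> at some time.
\<close>
lemma AE_all_times_imp_all:
  assumes "AE \<omega> in M. \<forall>t\<ge>0. P (W t \<omega>)"
  shows "P x"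
proof -
  obtain \<omega> where \<omega>: "\<forall>t\<ge>0. P (W t \<omega>)" "continuous_on {0..} (\<lambda>t. W t \<omega>)" "W 1 \<omega> < x" "x < W 2 \<omega>"
    by (rule ex_upcrossing_path[OF assms, of x])
  have "continuous_on {1..2} (\<lambda>t. W t \<omega>)"
    using \<omega>(2) by (rule continuous_on_subset) auto
  then obtain t where "1 \<le> t" "W t \<omega> = x"
    using IVT'[of "\<lambda>t. W t \<omega>" 1 x 2] \<omega>(3,4) by auto
  then show ?thesis using \<omega>(1)[rule_format, of t] by simp
qed

text \<open>
  A single good path settles each side of each level: one that crosses \<open>x\<close> upwards gives
  continuity from the right, one that crosses it downwards gives continuity from the left.
\<close>
lemma right_continuous_paths_imp_continuous:
  fixes g :: "real \<Rightarrow> real"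
  assumes rc: "AE \<omega> in M. \<forall>t\<ge>0. continuous (at_right t) (\<lambda>u. g (W u \<omega>))"
  shows "continuous_on UNIV g"
proof (rule continuous_at_imp_continuous_on, rule ballI)
  fix x
  have "continuous (at_right x) g"
  proof -
    obtain \<omega> where \<omega>: "\<forall>t\<ge>0. continuous (at_right t) (\<lambda>u. g (W u \<omega>))"
        "continuous_on {0..} (\<lambda>t. W t \<omega>)" "W 1 \<omega> < x" "x < W 2 \<omega>"
      by (rule ex_upcrossing_path[OF rc, of x])
    show ?thesis
    proof (rule path_crossing_right_continuous[where a = 1 and b = 2 and w = "\<lambda>t. W t \<omega>"])
      show "continuous_on {1..2} (\<lambda>t. W t \<omega>)"
        using \<omega>(2) by (rule continuous_on_subset) auto
    qed (use \<omega> in auto)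
  qed
  moreover have "continuous (at_left x) g"
  proof -
    obtain \<omega> where \<omega>: "\<forall>t\<ge>0. continuous (at_right t) (\<lambda>u. g (W u \<omega>))"
        "continuous_on {0..} (\<lambda>t. W t \<omega>)" "x < W 1 \<omega>" "W 2 \<omega> < x"
      by (rule ex_downcrossing_path[OF rc, of x])
    show ?thesis
    proof (rule path_crossing_left_continuous[where a = 1 and b = 2 and w = "\<lambda>t. W t \<omega>"])
      show "continuous_on {1..2} (\<lambda>t. W t \<omega>)"
        using \<omega>(2) by (rule continuous_on_subset) auto
    qed (use \<omega> in auto)
  qed
  ultimately show "isCont g x" by (simp add: continuous_at_split)
qed

section \<open>Brownian martingales of the form g(W)\<close>

text \<open>
  For \<open>A\<close> in \<open>F s\<close>, the indicator of \<open>A\<close> is independent of the centred increment after \<open>s\<close>, so the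
  increment has integral \<open>0\<close> over \<open>A\<close>.
\<close>
lemma W_martingale: "(\<lambda>t \<omega>. c * W t \<omega>) \<in> rc_martingales M F"
proof -
  have int_incr: "integrable M (\<lambda>\<omega>. W t \<omega> - W s \<omega>)" and exp_incr: "expectation (\<lambda>\<omega>. W t \<omega> - W s \<omega>) = 0"
    if st: "0 \<le> s" "s \<le> t" for s t
  proof -
    have "integrable M (\<lambda>\<omega>. W t \<omega> - W s \<omega>) \<and> expectation (\<lambda>\<omega>. W t \<omega> - W s \<omega>) = 0"
    proof (cases "s = t")
      case False
      then have D: "distributed M lborel (\<lambda>\<omega>. W t \<omega> - W s \<omega>) (normal_density 0 (sqrt (t - s)))"
        using st by (intro distributed_increment) auto
      show ?thesis
        using distributed_integrable[OF D, of "\<lambda>x. x"] distributed_integral[OF D, of "\<lambda>x. x"] st False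
        by (simp add: integrable_normal_moment_nz_1 integral_normal_moment_nz_1)
    qed simp
    then show "integrable M (\<lambda>\<omega>. W t \<omega> - W s \<omega>)" "expectation (\<lambda>\<omega>. W t \<omega> - W s \<omega>) = 0" by auto
  qed
  have int_W: "integrable M (W t)" if "0 \<le> t" for t
  proof -
    have "integrable M (\<lambda>\<omega>. W t \<omega> - W 0 \<omega>)" using int_incr[of 0 t] that by simp
    moreover have "AE \<omega> in M. W t \<omega> - W 0 \<omega> = W t \<omega>" using W_0 by auto
    ultimately show ?thesis
      using integrable_cong_AE[of "\<lambda>\<omega>. W t \<omega> - W 0 \<omega>" M "W t"] W_measurable[of t] W_measurable[of 0] that by auto
  qed
  have cond: "AE \<omega> in M. real_cond_exp M (F s) (\<lambda>\<omega>. c * W t \<omega>) \<omega> = c * W s \<omega>"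
    if st: "0 \<le> s" "s \<le> t" for s t
  proof -
    interpret sigma_finite_subalgebra M "F s" using sigma_finite_subalgebra_F[OF st(1)] .
    show ?thesis
    proof (rule real_cond_exp_charact)
      fix A assume A: "A \<in> sets (F s)"
      then have A': "A \<in> events" using subalgebra_F[OF st(1)] by (auto simp: subalgebra_def)
      have "indep_var borel (indicator A :: 'a \<Rightarrow> real) borel (\<lambda>\<omega>. W t \<omega> - W s \<omega>)"
        using A by (intro indep_past_increment st) auto
      then have "expectation (\<lambda>\<omega>. indicator A \<omega> * (W t \<omega> - W s \<omega>)) = 0"
        using int_incr[OF st] exp_incr[OF st] A'
        by (subst indep_var_lebesgue_integral) (auto simp: emeasure_eq_measure)
      then have "expectation (\<lambda>\<omega>. W t \<omega> * indicator A \<omega> - W s \<omega> * indicator A \<omega>) = 0"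
        by (simp add: right_diff_distrib mult.commute)
      then have "expectation (\<lambda>\<omega>. W t \<omega> * indicator A \<omega>) = expectation (\<lambda>\<omega>. W s \<omega> * indicator A \<omega>)"
        using int_W[of t] int_W[of s] st integrable_real_mult_indicator[OF A']
        by (subst (asm) Bochner_Integration.integral_diff) auto
      then show "(\<integral>x\<in>A. c * W t x \<partial>M) = (\<integral>x\<in>A. c * W s x \<partial>M)"
        by (simp add: set_lebesgue_integral_def mult_ac)
    qed (use st int_W W_adapted in auto)
  qed
  have rc: "AE \<omega> in M. \<forall>t\<ge>0. continuous (at_right t) (\<lambda>u. c * W u \<omega>)"
    using W_continuous
  proof eventually_elim
    fix \<omega> assume cont: "continuous_on {0..} (\<lambda>t. W t \<omega>)"
    show "\<forall>t\<ge>0. continuous (at_right t) (\<lambda>u. c * W u \<omega>)"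
    proof (intro allI impI continuous_mult continuous_const)
      fix t :: real assume "0 \<le> t"
      then have "continuous (at t within {0..}) (\<lambda>u. W u \<omega>)"
        using cont by (simp add: continuous_on_eq_continuous_within)
      then show "continuous (at_right t) (\<lambda>u. W u \<omega>)"
        using \<open>0 \<le> t\<close> by (elim continuous_within_subset) auto
    qed
  qed
  show ?thesis
    unfolding rc_martingales_def using W_adapted int_W cond rc by auto
qed

lemma integrable_process_imp_gaussian_integrable:
  assumes g: "g \<in> borel_measurable borel" and "\<And>t. 0 \<le> t \<Longrightarrow> integrable M (\<lambda>\<omega>. g (W t \<omega>))"
  shows "gaussian_integrable g"
  unfolding gaussian_integrable_def
proof (intro allI impI)
  fix u :: real assume "0 < u"
  then show "integrable lborel (\<lambda>y. normal_density 0 (sqrt u) y * g y)"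
    using distributed_integrable[OF distributed_W[of u], of g] g assms(2)[of u] by simp
qed

text \<open>
  By independence, the joint law of \<open>W\<^sub>1\<close> and the increment \<open>Z\<close> up to time \<open>1 + u\<close> is a product.
  Testing the martingale property on the events that \<open>W\<^sub>1\<close> lies in a Borel set \<open>A\<close> and applying Fubini
  identifies \<open>g\<close> with its Gaussian mean, almost everywhere under the law of \<open>W\<^sub>1\<close>. This law has the
  same null sets as Lebesgue measure. The starting time \<open>1\<close> is an arbitrary positive time: at time
  \<open>0\<close> the law of \<open>W\<close> is concentrated at a point.
\<close>
lemma martingale_imp_gaussian_mean_AE:
  assumes g: "g \<in> borel_measurable borel"
    and mart: "(\<lambda>t \<omega>. g (W t \<omega>)) \<in> rc_martingales M F"
    and u: "0 < u"
  shows "AE x in lborel. gaussian_mean u g x = g x"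
proof -
  define Z where "Z \<omega> = W (1 + u) \<omega> - W 1 \<omega>" for \<omega>
  let ?X = "distr M borel (W 1)" and ?Z = "distr M borel Z"
  have Z_distr: "distributed M lborel Z (normal_density 0 (sqrt u))"
    unfolding Z_def using distributed_increment[of 1 "1 + u"] u by simp
  have meas[measurable]: "W 1 \<in> borel_measurable M" "Z \<in> borel_measurable M"
    using W_measurable[of 1] W_measurable[of "1 + u"] u by (auto simp: Z_def[abs_def])
  note g[measurable]
  interpret X: prob_space ?X by (rule prob_space_distr) measurable
  interpret Z: prob_space ?Z by (rule prob_space_distr) measurable
  interpret XZ: pair_prob_space ?X ?Z ..
  have joint: "distr M (borel \<Otimes>\<^sub>M borel) (\<lambda>\<omega>. (W 1 \<omega>, Z \<omega>)) = ?X \<Otimes>\<^sub>M ?Z"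
    using indep_past_increment[of 1 "1 + u" "W 1"] W_adapted[of 1] u
    by (simp add: indep_var_distribution_eq Z_def[abs_def])
  have int: "integrable M (\<lambda>\<omega>. g (W t \<omega>))" if "0 \<le> t" for t
    using mart that by (auto simp: rc_martingales_def)
  have sum: "W 1 \<omega> + Z \<omega> = W (1 + u) \<omega>" for \<omega> by (simp add: Z_def)
  have int2: "integrable (?X \<Otimes>\<^sub>M ?Z) (\<lambda>(x, z). g (x + z))"
    unfolding joint[symmetric] using int[of "1 + u"] u
    by (subst integrable_distr_eq) (auto simp: sum split_beta)
  define h where "h x = (\<integral>z. g (x + z) \<partial>?Z)" for x
  have "AE x in ?X. h x = g x"
  proof (rule density_unique_real)
    show "integrable ?X h" unfolding h_def using XZ.integrable_fst'[OF int2] by simp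
    show "integrable ?X g" using int[of 1] by (subst integrable_distr_eq) auto
    fix A assume "A \<in> sets ?X"
    then have A[measurable]: "A \<in> sets borel" by simp
    let ?E = "W 1 -` A \<inter> space M"
    have E: "?E \<in> sets (F 1)"
      using measurable_sets[OF W_adapted[of 1] A] subalgebra_F[of 1] by (simp add: subalgebra_def)
    interpret sigma_finite_subalgebra M "F 1" by (rule sigma_finite_subalgebra_F) simp
    have int3: "integrable (?X \<Otimes>\<^sub>M ?Z) (\<lambda>(x, z). indicator A x * g (x + z))"
    proof (rule Bochner_Integration.integrable_bound[OF int2])
      show "(\<lambda>(x, z). indicator A x * g (x + z)) \<in> borel_measurable (?X \<Otimes>\<^sub>M ?Z)" by measurable
    qed (auto simp: indicator_def)
    have "(\<integral>x\<in>A. h x \<partial>?X) = (\<integral>x. (\<integral>z. indicator A x * g (x + z) \<partial>?Z) \<partial>?X)"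
      by (simp add: set_lebesgue_integral_def h_def)
    also have "\<dots> = (\<integral>p. (case p of (x, z) \<Rightarrow> indicator A x * g (x + z)) \<partial>(?X \<Otimes>\<^sub>M ?Z))"
      using XZ.integral_fst'[OF int3] by simp
    also have "\<dots> = expectation (\<lambda>\<omega>. indicator A (W 1 \<omega>) * g (W (1 + u) \<omega>))"
      unfolding joint[symmetric] by (subst integral_distr) (auto simp: sum)
    also have "\<dots> = (\<integral>\<omega>\<in>?E. g (W (1 + u) \<omega>) \<partial>M)"
      unfolding set_lebesgue_integral_def
      by (intro Bochner_Integration.integral_cong) (auto simp: indicator_def)
    also have "\<dots> = (\<integral>\<omega>\<in>?E. real_cond_exp M (F 1) (\<lambda>\<omega>. g (W (1 + u) \<omega>)) \<omega> \<partial>M)"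
      using int[of "1 + u"] E u by (intro real_cond_exp_intA) auto
    also have "\<dots> = (\<integral>\<omega>\<in>?E. g (W 1 \<omega>) \<partial>M)"
      unfolding set_lebesgue_integral_def
    proof (rule integral_cong_AE)
      have "AE \<omega> in M. real_cond_exp M (F 1) (\<lambda>\<omega>. g (W (1 + u) \<omega>)) \<omega> = g (W 1 \<omega>)"
        using mart u by (auto simp: rc_martingales_def)
      then show "AE \<omega> in M. indicat_real ?E \<omega> *\<^sub>R real_cond_exp M (F 1) (\<lambda>\<omega>. g (W (1 + u) \<omega>)) \<omega>
          = indicat_real ?E \<omega> *\<^sub>R g (W 1 \<omega>)" by eventually_elim simp
    qed measurable
    also have "\<dots> = (\<integral>x\<in>A. g x \<partial>?X)"
      unfolding set_lebesgue_integral_def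
      by (subst integral_distr) (auto intro!: Bochner_Integration.integral_cong simp: indicator_def)
    finally show "(\<integral>x\<in>A. h x \<partial>?X) = (\<integral>x\<in>A. g x \<partial>?X)" .
  qed
  moreover have "h x = gaussian_mean u g x" for x
  proof -
    have "h x = expectation (\<lambda>\<omega>. g (x + Z \<omega>))"
      unfolding h_def by (subst integral_distr) auto
    also have "\<dots> = (\<integral>z. normal_density 0 (sqrt u) z * g (x + z) \<partial>lborel)"
      using distributed_integral[OF Z_distr, of "\<lambda>z. g (x + z)"] by simp
    also have "\<dots> = (\<integral>z. normal_density x (sqrt u) (x + z) * g (x + z) \<partial>lborel)"
      by (simp add: normal_density_def)
    also have "\<dots> = gaussian_mean u g x"
      unfolding gaussian_mean_def
      using lborel_integral_real_affine[of 1 "\<lambda>y. normal_density x (sqrt u) y * g y" x] by simp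
    finally show ?thesis .
  qed
  ultimately have AE_X: "AE x in ?X. gaussian_mean u g x = g x" by simp
  have X_density: "?X = density lborel (normal_density 0 1)"
  proof -
    have "?X = distr M lborel (W 1)" by (rule distr_cong) auto
    also have "\<dots> = density lborel (normal_density 0 1)"
      using distributed_W[of 1] by (simp add: distributed_def)
    finally show ?thesis .
  qed
  show ?thesis
    using AE_X unfolding X_density by (simp add: AE_density normal_density_pos)
qed

text \<open>
  Continuity is used twice: it makes \<open>g\<close> Borel, as Fubini requires, and it upgrades the identity with
  the Gaussian mean from almost every point to every point. The initial value removes the constant
  term of the affine function.
\<close>
lemma martingale_imp_linear:
  fixes g :: "real \<Rightarrow> real"
  assumes mart: "(\<lambda>t \<omega>. g (W t \<omega>)) \<in> rc_martingales M F"
    and init: "AE \<omega> in M. g (W 0 \<omega>) = 0"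
  shows "\<exists>c. \<forall>x. g x = c * x"
proof -
  have cont: "continuous_on UNIV g"
    using mart by (intro right_continuous_paths_imp_continuous) (auto simp: rc_martingales_def)
  then have g: "g \<in> borel_measurable borel" by (rule borel_measurable_continuous_onI)
  have gi: "gaussian_integrable g"
    using g mart by (intro integrable_process_imp_gaussian_integrable) (auto simp: rc_martingales_def)
  have "gaussian_mean u g x = g x" if u: "0 < u" for u x
  proof -
    have "closed {x. gaussian_mean u g x = g x}"
      using continuous_gaussian_mean[OF gi g u] cont by (intro closed_Collect_eq)
    moreover have "AE x in lebesgue. x \<in> {x. gaussian_mean u g x = g x}"
      using martingale_imp_gaussian_mean_AE[OF g mart u] by (auto intro: AE_completion)
    ultimately show ?thesis using mem_closed_if_AE_lebesgue[of "{x. gaussian_mean u g x = g x}"] by blast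
  qed
  then have affine: "g x = g 0 + (g 1 - g 0) * x" for x
    by (rule gaussian_invariant_imp_affine[OF cont gi])
  have "AE \<omega> in M. g 0 = 0" using init W_0 by eventually_elim simp
  then have "g 0 = 0" by simp
  then have "g x = g 1 * x" for x using affine[of x] by simp
  then show ?thesis by blast
qed

lemma martingale_iff_linear:
  fixes g :: "real \<Rightarrow> real"
  shows "(\<lambda>t \<omega>. g (W t \<omega>)) \<in> rc_martingales M F \<and> (AE \<omega> in M. g (W 0 \<omega>) = 0) \<longleftrightarrow> (\<exists>c. \<forall>x. g x = c * x)"
proof (intro iffI)
  assume "\<exists>c. \<forall>x. g x = c * x"
  then obtain c where "g = (\<lambda>x. c * x)" by auto
  then show "(\<lambda>t \<omega>. g (W t \<omega>)) \<in> rc_martingales M F \<and> (AE \<omega> in M. g (W 0 \<omega>) = 0)"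
    using W_martingale[of c] W_0 by auto
qed (use martingale_imp_linear in blast)

text \<open>
  Positivity has to be established at every point before \<open>ln (f x) = c * x\<close> can be solved for \<open>f x\<close>,
  because \<open>ln\<close> also takes values at nonpositive arguments.
\<close>
lemma positive_log_martingale_iff_exponential:
  fixes f :: "real \<Rightarrow> real"
  shows "(AE \<omega> in M. \<forall>t\<ge>0. f (W t \<omega>) > 0) \<and> (\<lambda>t \<omega>. ln (f (W t \<omega>))) \<in> rc_martingales M F
      \<and> (AE \<omega> in M. ln (f (W 0 \<omega>)) = 0) \<longleftrightarrow> (\<exists>c. \<forall>x. f x = exp (c * x))"
    (is "?pos \<and> ?mart \<and> ?init \<longleftrightarrow> _")
proof
  assume *: "?pos \<and> ?mart \<and> ?init"
  then have pos: "f x > 0" for x by (intro AE_all_times_imp_all[where P = "\<lambda>y. f y > 0"]) simp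
  obtain c where c: "\<And>x. ln (f x) = c * x"
    using * martingale_iff_linear[of "\<lambda>x. ln (f x)"] by blast
  have "f x = exp (c * x)" for x unfolding c[symmetric] using pos by simp
  then show "\<exists>c. \<forall>x. f x = exp (c * x)" by blast
next
  assume "\<exists>c. \<forall>x. f x = exp (c * x)"
  then obtain c where c: "\<And>x. f x = exp (c * x)" by blast
  then have "\<exists>c. \<forall>x. ln (f x) = c * x" by auto
  then show "?pos \<and> ?mart \<and> ?init"
    using martingale_iff_linear[of "\<lambda>x. ln (f x)"] by (simp add: c)
qed

end

section \<open>The characterisation of the Cauchy equations\<close>

theorem theorem2p2:
  fixes M :: "'a measure"
    and F :: "real \<Rightarrow> 'a measure"
    and W :: "real \<Rightarrow> 'a \<Rightarrow> real"
  assumes "prob_space M"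
    and "complete_measure M"
    and "usual_filtration M F"
    and "standard_brownian_motion M W"
    and "\<forall>t\<ge>0. sets (natural_filtration M W t) \<subseteq> sets (F t)"
    and "increments_indep_of M F W"
    and "\<exists>B. standard_brownian_motion M B \<and>
             (\<forall>t\<ge>0. sets (natural_filtration M B t) \<subseteq> sets (F t)) \<and>
             indep_processes M B W"
  shows
    "(\<forall>f :: real \<Rightarrow> real.
        (f \<in> borel_measurable lebesgue \<and> (\<exists>x. f x \<noteq> 0) \<and> (\<forall>x y. f (x + y) = f x * f y)) \<longleftrightarrow>
        ((AE \<omega> in M. \<forall>t\<ge>0. f (W t \<omega>) > 0) \<and>
         (\<lambda>t \<omega>. ln (f (W t \<omega>))) \<in> rc_martingales M F \<and>
         (AE \<omega> in M. ln (f (W 0 \<omega>)) = 0)))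
     \<and>
     (\<forall>f :: real \<Rightarrow> real.
        (f \<in> borel_measurable (lebesgue_on {0<..}) \<and> (\<forall>x>0. \<forall>y>0. f x + f y = f (x * y))) \<longleftrightarrow>
        ((\<lambda>t \<omega>. f (exp (W t \<omega>))) \<in> rc_martingales M F \<and>
         (AE \<omega> in M. f (exp (W 0 \<omega>)) = 0)))
     \<and>
     (\<forall>f :: real \<Rightarrow> real.
        (f \<in> borel_measurable (lebesgue_on {0<..}) \<and> (\<exists>x>0. f x \<noteq> 0) \<and>
         (\<forall>x>0. \<forall>y>0. f (x * y) = f x * f y)) \<longleftrightarrow>
        ((AE \<omega> in M. \<forall>t\<ge>0. f (exp (W t \<omega>)) > 0) \<and>
         (\<lambda>t \<omega>. ln (f (exp (W t \<omega>)))) \<in> rc_martingales M F \<and>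
         (AE \<omega> in M. ln (f (exp (W 0 \<omega>))) = 0)))"
proof -
  interpret brownian_filtration M F W
    using assms by (intro brownian_filtration.intro brownian_filtration_axioms.intro)
  show ?thesis
    using exponential_equation_iff logarithmic_equation_iff power_equation_iff
      positive_log_martingale_iff_exponential
      positive_log_martingale_iff_exponential[of "\<lambda>x. f (exp x)" for f]
      martingale_iff_linear[of "\<lambda>x. f (exp x)" for f]
    by (intro conjI allI) (simp_all only:)
qed

end
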